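(* Let $n \ge d \ge 2$, let $X \in \mathbb{R}^{n\times d}$ have $\operatorname{rank}(X) = d$, and let $f:\mathbb{R}^{n\times d}\to\mathbb{R}^{n\times d}$ be a vector field. Put $\dot P = f(X)X^\top + X f(X)^\top$. Then $\dot P = 0$ if and only if $f(X) = XA$ for some skew-symmetric matrix $A \in \mathfrak{so}(d)$.
   Context: $\mathfrak{so}(d)$ denotes the space of real skew-symmetric $d\times d$ matrices. For dynamics $\dot X = f(X)$ on latent positions $X\in\mathbb{R}^{n\times d}$, the matrix $\dot P = f(X)X^\top + Xf(X)^\top$ is the induced velocity of the probability matrix $P = XX^\top$; the dynamics are called invisible at $X$ when $\dot P = 0$. *)

theory Defs
  imports "HOL-Analysis.Analysis"
begin

definition so :: "(real ^ 'd ^ 'd) set" where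
  "so = {A. transpose A = - A}"

definition P_dot :: "(real ^ 'd ^ 'n \<Rightarrow> real ^ 'd ^ 'n) \<Rightarrow> real ^ 'd ^ 'n \<Rightarrow> real ^ 'n ^ 'n" where
  "P_dot f X = f X ** transpose X + X ** transpose (f X)"

end

theory Submission
  imports Defs
begin

text \<open>A left inverse \<open>B\<close> of the full-rank matrix \<open>X\<close> cancels the factor \<open>X\<^sup>T\<close> on the right in
  \<open>f(X) X\<^sup>T = - X f(X)\<^sup>T\<close>, so \<open>f(X) = X A\<close> with \<open>A = - (B f(X))\<^sup>T\<close>. Multiplying by \<open>B\<close> on the left
  gives \<open>A = B f(X)\<close>, so \<open>A\<close> is skew-symmetric.\<close>

lemma matrix_mul_minus_right:
  fixes A :: "real ^ 'm ^ 'n" and B :: "real ^ 'k ^ 'm"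
  shows "A ** (- B) = - (A ** B)"
  by (simp add: matrix_matrix_mult_def vec_eq_iff sum_negf)

lemma matrix_mul_minus_left:
  fixes A :: "real ^ 'm ^ 'n" and B :: "real ^ 'k ^ 'm"
  shows "(- A) ** B = - (A ** B)"
  by (simp add: matrix_matrix_mult_def vec_eq_iff sum_negf)

theorem theorem1:
  fixes X :: "real ^ 'd ^ 'n" and f :: "real ^ 'd ^ 'n \<Rightarrow> real ^ 'd ^ 'n"
  assumes "CARD('n) \<ge> CARD('d)" and "CARD('d) \<ge> 2" and "rank X = CARD('d)"
  shows "P_dot f X = 0 \<longleftrightarrow> (\<exists>A \<in> so. f X = X ** A)"
proof
  assume "P_dot f X = 0"
  then have anti: "f X ** transpose X = - (X ** transpose (f X))"
    by (simp add: P_dot_def eq_neg_iff_add_eq_0)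
  \<comment> \<open>Rank equal to the number of columns makes \<open>X\<close> injective as a linear
    map, hence left invertible.\<close>
  obtain B where B: "B ** X = mat 1"
    using assms(3) full_rank_injective matrix_left_invertible_injective by blast
  have BT: "transpose X ** transpose B = mat 1"
    by (metis B matrix_transpose_mul transpose_mat)
  define A where "A = - transpose (B ** f X)"
  have "f X = (f X ** transpose X) ** transpose B"
    by (simp add: matrix_mul_assoc [symmetric] BT)
  also have "\<dots> = X ** A"
    by (simp add: anti A_def matrix_transpose_mul matrix_mul_minus_left
        matrix_mul_minus_right matrix_mul_assoc)
  finally have fX: "f X = X ** A" .
  then have "B ** f X = A"
    by (simp add: matrix_mul_assoc B)
  \<comment> \<open>Putting \<open>B ** f X = A\<close> into the definition of \<open>A\<close>
    turns it into \<open>A = - transpose A\<close>.\<close>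
  then have "transpose A = - A"
    using A_def by (metis minus_minus)
  then show "\<exists>A \<in> so. f X = X ** A"
    using fX by (auto simp: so_def)
next
  assume "\<exists>A \<in> so. f X = X ** A"
  then obtain A where "transpose A = - A" "f X = X ** A"
    by (auto simp: so_def)
  \<comment> \<open>The two summands are \<open>X ** A ** transpose X\<close> and
    \<open>X ** transpose A ** transpose X\<close>, which cancel by skew-symmetry.\<close>
  then show "P_dot f X = 0"
    by (simp add: P_dot_def matrix_transpose_mul matrix_mul_minus_left
        matrix_mul_minus_right matrix_mul_assoc)
qed

end
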